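(* Let $(L;V)$ be a nonnegative pair, with $L\in\mathbb{R}^{n\times n}$, $V\in\mathbb{R}^{n\times p}$, $0\le p\le n$. Let $Q\in\mathbb{R}^{n\times p}$ have columns forming an orthonormal basis of the column span of $V$, let $\widetilde L=(I-QQ^\top)L(I-QQ^\top)$, let $q=\operatorname{rank}\widetilde L$, and let $\widetilde L=\widetilde U\widetilde\Lambda\widetilde U^\top$ be its truncated spectral decomposition, with $\widetilde\Lambda=\operatorname{diag}(\widetilde\lambda_1,\dots,\widetilde\lambda_q)$ the nonzero eigenvalues and $\widetilde U\in\mathbb{R}^{n\times q}$ the matrix of corresponding orthonormal eigenvectors. Then for any subset $X\subseteq\{1,\dots,n\}$ of size $|X|=m$ with $p\le m\le p+q$, $$(-1)^p\det\begin{pmatrix}L_X&V_{X,:}\\(V_{X,:})^\top&0\end{pmatrix}=\det(V^\top V)\sum_{Y\subseteq\{1,\dots,q\},\,|Y|=m-p}\Big(\det\begin{bmatrix}Q_{X,:}&\widetilde U_{X,Y}\end{bmatrix}\Big)^2\prod_{i\in Y}\widetilde\lambda_i .$$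
   Context: All matrices are real. For a matrix $A$ and index sets $X,Y$, $A_{X,Y}$ is the submatrix with rows in $X$ and columns in $Y$, $A_X=A_{X,X}$, and $A_{X,:}$ keeps the rows in $X$ and all columns. The determinant of an empty matrix and an empty product equal $1$. Nonnegative pair (NNP): a pair $(L;V)$ with $L\in\mathbb{R}^{n\times n}$ symmetric, $V\in\mathbb{R}^{n\times p}$, $0\le p\le n$, $V$ of full column rank, and $L$ conditionally positive semi-definite with respect to $V$, i.e. $x^\top Lx\ge 0$ for all $x\in\mathbb{R}^n$ with $V^\top x=0$. (The case $p=0$ is allowed: then $L$ is positive semi-definite, and $\widetilde L=L$.) *)

theory Defs
  imports
    "Jordan_Normal_Form.DL_Rank"
    "Jordan_Normal_Form.DL_Submatrix"
    "Jordan_Normal_Form.Char_Poly"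
begin

text \<open>
  Matrices have explicit dimensions (the carrier sets), so the dimensions 0 are allowed, the
  determinant of the empty matrix is 1, and row and column indices start at 0: the index set
  of \<open>n\<close> rows is \<open>{..<n}\<close>.  In \<open>submatrix A X Y\<close> the selected rows and columns keep their
  increasing order, and \<open>submatrix A X UNIV\<close> keeps all columns.
\<close>

definition nonnegative_pair :: "nat \<Rightarrow> nat \<Rightarrow> real mat \<Rightarrow> real mat \<Rightarrow> bool" where
  "nonnegative_pair n p L V \<longleftrightarrow>
     p \<le> n \<and>
     L \<in> carrier_mat n n \<and> transpose_mat L = L \<and>
     V \<in> carrier_mat n p \<and> vec_space.rank n V = p \<and>
     (\<forall>x \<in> carrier_vec n. transpose_mat V *\<^sub>v x = 0\<^sub>v p \<longrightarrow> x \<bullet> (L *\<^sub>v x) \<ge> 0)"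

definition orthonormal_cols :: "real mat \<Rightarrow> bool" where
  "orthonormal_cols Q \<longleftrightarrow>
     (\<forall>i < dim_col Q. \<forall>j < dim_col Q. col Q i \<bullet> col Q j = (if i = j then 1 else 0))"

text \<open>Linear independence of the columns is implied by their orthonormality.\<close>

definition orthonormal_basis_of_col_space :: "nat \<Rightarrow> nat \<Rightarrow> real mat \<Rightarrow> real mat \<Rightarrow> bool" where
  "orthonormal_basis_of_col_space n p Q V \<longleftrightarrow>
     Q \<in> carrier_mat n p \<and> orthonormal_cols Q \<and>
     vec_space.col_space n Q = vec_space.col_space n V"

text \<open>
  The number \<open>q\<close> of columns of \<open>U\<close> is the rank of \<open>A\<close>, so the \<open>lam i\<close> with \<open>i < q\<close> list
  all nonzero eigenvalues of \<open>A\<close>, repeated according to their multiplicity, in any order.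
\<close>

definition truncated_spectral_decomposition ::
    "nat \<Rightarrow> nat \<Rightarrow> real mat \<Rightarrow> real mat \<Rightarrow> (nat \<Rightarrow> real) \<Rightarrow> bool" where
  "truncated_spectral_decomposition n q A U lam \<longleftrightarrow>
     q = vec_space.rank n A \<and>
     U \<in> carrier_mat n q \<and> orthonormal_cols U \<and>
     (\<forall>i < q. lam i \<noteq> 0 \<and> eigenvector A (col U i) (lam i)) \<and>
     A = U * mat_diag q lam * transpose_mat U"

definition append_cols :: "'a :: zero mat \<Rightarrow> 'a mat \<Rightarrow> 'a mat" where
  "append_cols A B = four_block_mat A B (0\<^sub>m 0 (dim_col A)) (0\<^sub>m 0 (dim_col B))"

end

theory Submission
  imports Defs
begin

text \<open>
  Write \<open>S(M, P)\<close> for the block matrix with blocks \<open>M\<close>, \<open>P\<close>, \<open>P\<^sup>T\<close>, \<open>0\<close>; the determinant to be expanded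
  is that of \<open>S(L\<^sub>X, V\<^sub>X)\<close>.  The proof has two parts.

  The first part replaces \<open>L\<close> and \<open>V\<close> by the projected matrix and \<open>Q\<close>.  Since the columns of \<open>V\<close> lie
  in the span of those of \<open>Q\<close>, there is a square \<open>R\<close> with \<open>V = Q R\<close>.  Block-diagonal
  factors extract \<open>(det R)\<^sup>2\<close> from \<open>S(L\<^sub>X, Q\<^sub>X R)\<close> (\<open>det_saddle_mat_mult_right\<close>), and
  \<open>(det R)\<^sup>2 = det (V\<^sup>T V)\<close> because \<open>Q\<^sup>T Q = 1\<close>.  Furthermore \<open>L\<close> differs from the projected matrix by terms
  \<open>Q C + D Q\<^sup>T\<close> (\<open>split_off_projection\<close>).  This shape survives the restriction to \<open>X\<close>, where
  block elimination against the borders \<open>Q\<^sub>X\<close> and \<open>Q\<^sub>X\<^sup>T\<close> removes it (\<open>det_saddle_mat_shift\<close>).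

  The second part expands the determinant of \<open>S(M, P)\<close> for \<open>M = \<Sum>i\<in>I. lam i * u\<^sub>i u\<^sub>i\<^sup>T\<close>
  (\<open>det_saddle_mat_spectral_sum\<close>).  It replaces a double application of the Cauchy-Binet formula by
  an induction on \<open>I\<close>.  A rank-one update satisfies
  \<open>det S(M + c u u\<^sup>T, P) = det S(M, P) - c det S(M, [P u])\<close> (\<open>det_saddle_mat_add_rank_one\<close>): a term
  \<open>c u u\<^sup>T\<close> is either dropped, or \<open>u\<close> becomes a new column of the border at the price of the factor
  \<open>- c\<close>.  Once all terms are used up, the summands belong to the sets \<open>Y\<close> of indices whose vectors
  were moved to the border, and they contain \<open>det S(0, [P U\<^sub>Y])\<close>, which up to sign is the square of
  \<open>det [P U\<^sub>Y]\<close> if that matrix is square and vanishes otherwise (\<open>det_saddle_mat_zero\<close>).  The signs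
  collected on the way cancel against \<open>(-1)\<^sup>p\<close>.
\<close>

section \<open>Rank-one updates of a determinant\<close>

lemma det_border_corner:
  fixes N W Z :: "'a :: idom mat"
  assumes N: "N \<in> carrier_mat k k" and W: "W \<in> carrier_mat k 1" and Z: "Z \<in> carrier_mat 1 k"
  shows "det (four_block_mat N W Z (mat 1 1 (\<lambda>_. d))) =
    det (four_block_mat N W Z (0\<^sub>m 1 1)) + d * det N"
proof -
  define A where "A e = four_block_mat N W Z (mat 1 1 (\<lambda>_. e))" for e
  have A: "A e \<in> carrier_mat (Suc k) (Suc k)" for e
    unfolding A_def using N by auto
  have del: "mat_delete (A e) k j = mat_delete (A 0) k j" if "j \<le> k" for e j
    using that N W Z unfolding A_def mat_delete_def by (auto intro!: eq_matI)
  have del_k: "mat_delete (A 0) k k = N"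
    using N W Z unfolding A_def mat_delete_def by (auto intro!: eq_matI)
  have entry: "A e $$ (k, j) = A 0 $$ (k, j)" if "j < k" for e j
    using that N W Z unfolding A_def by auto
  have corner: "A e $$ (k, k) = e" for e
    using N W Z unfolding A_def by auto
  have "det (A d) = (\<Sum>j<Suc k. A d $$ (k, j) * cofactor (A d) k j)"
    by (rule laplace_expansion_row[OF A]) simp
  also have "\<dots> = (\<Sum>j<k. A 0 $$ (k, j) * cofactor (A 0) k j) + d * det N"
    using del[where e = d] entry[where e = d] by (simp add: cofactor_def corner del_k)
  also have "(\<Sum>j<k. A 0 $$ (k, j) * cofactor (A 0) k j)
      = (\<Sum>j<Suc k. A 0 $$ (k, j) * cofactor (A 0) k j)"
    by (simp add: corner)
  also have "\<dots> = det (A 0)"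
    by (rule laplace_expansion_row[OF A, symmetric]) simp
  also have "A 0 = four_block_mat N W Z (0\<^sub>m 1 1)"
    unfolding A_def by (rule arg_cong[where f = "four_block_mat N W Z"]) (auto intro!: eq_matI)
  finally show ?thesis unfolding A_def .
qed

text \<open>
  Put the entry \<open>-1\<close> into the corner of the bordered matrix \<open>[N, cW; Z, -1]\<close>.  Eliminating \<open>Z\<close> with
  the help of this entry produces the rank-one update, while linearity in the corner produces the
  determinants on the right.
\<close>

lemma det_add_rank_one:
  fixes N W Z :: "'a :: idom mat"
  assumes N: "N \<in> carrier_mat k k" and W: "W \<in> carrier_mat k 1" and Z: "Z \<in> carrier_mat 1 k"
  shows "det (N + c \<cdot>\<^sub>m (W * Z)) = det N - c * det (four_block_mat N W Z (0\<^sub>m 1 1))"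
proof -
  let ?mi = "mat 1 1 (\<lambda>_. -1) :: 'a mat" and ?c = "mat 1 1 (\<lambda>_. c) :: 'a mat"
  let ?A = "four_block_mat N (c \<cdot>\<^sub>m W) Z ?mi"
  let ?E = "four_block_mat (1\<^sub>m k) (0\<^sub>m k 1) Z (1\<^sub>m 1)"
  let ?B = "four_block_mat N W Z (0\<^sub>m 1 1)"
  let ?F = "four_block_mat (1\<^sub>m k) (0\<^sub>m k 1) (0\<^sub>m 1 k) ?c"
  have cW: "c \<cdot>\<^sub>m W \<in> carrier_mat k 1" and WZ: "W * Z \<in> carrier_mat k k" using W Z by auto
  have A: "?A \<in> carrier_mat (k + 1) (k + 1)" and E: "?E \<in> carrier_mat (k + 1) (k + 1)"
    and B: "?B \<in> carrier_mat (k + 1) (k + 1)" and F: "?F \<in> carrier_mat (k + 1) (k + 1)"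
    using N by auto
  have detE: "det ?E = 1"
    by (subst det_four_block_mat_upper_right_zero[of _ k _ 1]) (use Z in auto)
  have detF: "det ?F = c"
    by (subst det_four_block_mat_upper_right_zero[of _ k _ 1]) (auto simp: det_single)
  have mZ: "?mi * Z = - Z"
    using Z by (auto intro!: eq_matI simp: scalar_prod_def)
  have "?A * ?E = four_block_mat (N + c \<cdot>\<^sub>m (W * Z)) (c \<cdot>\<^sub>m W) (0\<^sub>m 1 k) ?mi"
    using N W Z cW mZ
    by (subst mult_four_block_mat[of _ k k _ 1 _ 1 _ _ k _ 1])
       (auto simp: uminus_l_inv_mat mult_smult_assoc_mat[of _ k 1 _ k])
  then have "det ?A = - det (N + c \<cdot>\<^sub>m (W * Z))"
    using det_mult[OF A E] detE N cW WZ
    by (simp add: det_four_block_mat_lower_left_zero[of _ k _ 1] det_single)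
  moreover have "det ?A = c * det ?B - det N"
  proof -
    have "?B * ?F = four_block_mat N (c \<cdot>\<^sub>m W) Z (0\<^sub>m 1 1)"
    proof -
      have "W * ?c = c \<cdot>\<^sub>m W"
        using W by (auto intro!: eq_matI simp: scalar_prod_def)
      then show ?thesis
        using N W Z by (subst mult_four_block_mat[of _ k k _ 1 _ 1 _ _ k _ 1]) auto
    qed
    then have "det (four_block_mat N (c \<cdot>\<^sub>m W) Z (0\<^sub>m 1 1)) = det ?B * c"
      using det_mult[OF B F] detF by simp
    then show ?thesis
      using det_border_corner[OF N cW Z, of "-1"] by simp
  qed
  ultimately show ?thesis by (simp add: algebra_simps) 
qed

section \<open>Saddle matrices over a sum of rank-one matrices\<close>

lemma zero_append: "0\<^sub>v (m + p) = 0\<^sub>v m @\<^sub>v 0\<^sub>v p"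
  by auto

definition saddle_mat :: "'a :: zero mat \<Rightarrow> 'a mat \<Rightarrow> 'a mat" where
  "saddle_mat M P = four_block_mat M P (transpose_mat P) (0\<^sub>m (dim_col P) (dim_col P))"

lemma saddle_mat_carrier:
  "M \<in> carrier_mat m m \<Longrightarrow> P \<in> carrier_mat m p \<Longrightarrow> saddle_mat M P \<in> carrier_mat (m + p) (m + p)"
  unfolding saddle_mat_def by auto

text \<open>
  On the saddle matrix the update \<open>c u u\<^sup>T\<close> of \<open>M\<close> is the update \<open>c w w\<^sup>T\<close> with \<open>w = (u, 0)\<close>, and bordering
  the saddle matrix by \<open>w\<close> amounts to appending the column \<open>u\<close> to its border.
\<close>

lemma det_saddle_mat_add_rank_one:
  fixes M :: "'a :: idom mat"
  assumes M: "M \<in> carrier_mat m m" and u: "u \<in> carrier_vec m"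
  shows "det (saddle_mat (M + c \<cdot>\<^sub>m mat m m (\<lambda>(a, b). u $ a * u $ b)) (mat_of_cols m ws)) =
    det (saddle_mat M (mat_of_cols m ws)) - c * det (saddle_mat M (mat_of_cols m (ws @ [u])))"
proof -
  let ?p = "length ws"
  let ?P = "mat_of_cols m ws"
  let ?w = "u @\<^sub>v 0\<^sub>v ?p"
  let ?W = "mat (m + ?p) 1 (\<lambda>(a, _). ?w $ a)" and ?Z = "mat 1 (m + ?p) (\<lambda>(_, b). ?w $ b)"
  have S: "saddle_mat M ?P \<in> carrier_mat (m + ?p) (m + ?p)"
    using M by (intro saddle_mat_carrier) auto
  have "saddle_mat (M + c \<cdot>\<^sub>m mat m m (\<lambda>(a, b). u $ a * u $ b)) ?P
      = saddle_mat M ?P + c \<cdot>\<^sub>m (?W * ?Z)"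
    using M u unfolding saddle_mat_def
    by (auto intro!: eq_matI simp: scalar_prod_def)
  moreover have "four_block_mat (saddle_mat M ?P) ?W ?Z (0\<^sub>m 1 1)
      = saddle_mat M (mat_of_cols m (ws @ [u]))"
    using M u unfolding saddle_mat_def
    by (auto intro!: eq_matI simp: mat_of_cols_index nth_append)
  ultimately show ?thesis
    using det_add_rank_one[OF S, of ?W ?Z c] by simp
qed

lemma wide_mat_kernel_nontrivial:
  fixes W :: "'a :: idom mat"
  assumes W: "W \<in> carrier_mat r c" and "r < c"
  shows "\<exists>v \<in> carrier_vec c. v \<noteq> 0\<^sub>v c \<and> W *\<^sub>v v = 0\<^sub>v r"
proof -
  \<comment> \<open>\<open>W\<close> padded by zero rows to a square matrix\<close>
  define S where "S = mat\<^sub>r c c (\<lambda>i. if i = r then 0\<^sub>v c else if i < r then row W i else 0\<^sub>v c)"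
  have S: "S \<in> carrier_mat c c" unfolding S_def by auto
  have "det S = 0" unfolding S_def
    by (rule det_row_0) (use assms in auto)
  then obtain v where v: "v \<in> carrier_vec c" "v \<noteq> 0\<^sub>v c" and Sv: "S *\<^sub>v v = 0\<^sub>v c"
    using det_0_iff_vec_prod_zero[OF S] by auto
  have "row W i \<bullet> v = 0" if "i < r" for i
  proof -
    have "row S i = row W i" unfolding S_def using that assms by (auto intro!: eq_vecI)
    then show ?thesis
      using arg_cong[OF Sv, of "\<lambda>x. x $ i"] that assms S by auto
  qed
  then have "W *\<^sub>v v = 0\<^sub>v r" using W by (auto intro!: eq_vecI)
  with v show ?thesis by auto
qed

text \<open>
  If \<open>P\<close> is not square, then \<open>P\<close> or its transpose has more columns than rows, and a kernel vector
  of it, padded by zeros, is in the kernel of the saddle matrix.  The right-hand side is then zero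
  as well, because \<open>det\<close> is \<open>0\<close> on non-square matrices.
\<close>

lemma det_saddle_mat_zero:
  fixes P :: "'a :: idom mat"
  assumes P: "P \<in> carrier_mat m p"
  shows "(-1) ^ p * det (saddle_mat (0\<^sub>m m m) P) = (det P)\<^sup>2"
proof -
  have PT: "transpose_mat P \<in> carrier_mat p m" using P by simp
  have S: "saddle_mat (0\<^sub>m m m) P \<in> carrier_mat (m + p) (m + p)"
    using P by (intro saddle_mat_carrier) auto
  have mul: "saddle_mat (0\<^sub>m m m) P *\<^sub>v (x @\<^sub>v y) = (P *\<^sub>v y) @\<^sub>v (transpose_mat P *\<^sub>v x)"
    if x: "x \<in> carrier_vec m" and y: "y \<in> carrier_vec p" for x y
    using P x y unfolding saddle_mat_def
    by (subst four_block_mat_mult_vec[of _ m m _ p _ p]) auto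
  consider "m = p" | "p < m" | "m < p" by linarith
  then show ?thesis
  proof cases
    case 1
    have "saddle_mat (0\<^sub>m m m) P = four_block_mat (0\<^sub>m m m) P (transpose_mat P) (0\<^sub>m m m)"
      unfolding saddle_mat_def using P 1 by auto
    also have "det \<dots> = det (0\<^sub>m m m * 0\<^sub>m m m - P * transpose_mat P)"
      using P 1 by (intro det_four_block_mat) auto
    also have "0\<^sub>m m m * 0\<^sub>m m m - P * transpose_mat P = (-1) \<cdot>\<^sub>m (P * transpose_mat P)"
      using P by (auto intro!: eq_matI)
    also have "det \<dots> = (-1) ^ m * (det P * det (transpose_mat P))"
      using P 1 det_mult[of P m "transpose_mat P"] by (simp add: det_smult)
    also have "det (transpose_mat P) = det P" using P 1 by (intro det_transpose) auto
    finally show ?thesis using 1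
      by (simp add: power2_eq_square flip: mult.assoc power_mult_distrib)
  next
    case 2
    then obtain x where x: "x \<in> carrier_vec m" "x \<noteq> 0\<^sub>v m" "transpose_mat P *\<^sub>v x = 0\<^sub>v p"
      using wide_mat_kernel_nontrivial[OF PT] by auto
    have "saddle_mat (0\<^sub>m m m) P *\<^sub>v (x @\<^sub>v 0\<^sub>v p) = 0\<^sub>v (m + p)"
      using mul[OF x(1), of "0\<^sub>v p"] x P by (auto intro!: eq_vecI)
    moreover have "x @\<^sub>v 0\<^sub>v p \<noteq> 0\<^sub>v (m + p)"
      using append_vec_eq[OF x(1), of "0\<^sub>v m" "0\<^sub>v p" "0\<^sub>v p"] x(2) by (simp add: zero_append)
    ultimately have "det (saddle_mat (0\<^sub>m m m) P) = 0"
      using det_0_iff_vec_prod_zero[OF S] x by (metis append_carrier_vec zero_carrier_vec)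
    then show ?thesis using P 2 by (simp add: det_def)
  next
    case 3
    then obtain y where y: "y \<in> carrier_vec p" "y \<noteq> 0\<^sub>v p" "P *\<^sub>v y = 0\<^sub>v m"
      using wide_mat_kernel_nontrivial[OF P] by auto
    have "transpose_mat P *\<^sub>v 0\<^sub>v m = 0\<^sub>v p"
      using P by (auto intro!: eq_vecI simp: scalar_prod_def)
    then have "saddle_mat (0\<^sub>m m m) P *\<^sub>v (0\<^sub>v m @\<^sub>v y) = 0\<^sub>v (m + p)"
      using mul[OF _ y(1), of "0\<^sub>v m"] y P by (simp add: zero_append)
    moreover have "0\<^sub>v m @\<^sub>v y \<noteq> 0\<^sub>v (m + p)"
      using append_vec_eq[of "0\<^sub>v m" m "0\<^sub>v m" y "0\<^sub>v p"] y(2) by (simp add: zero_append)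
    ultimately have "det (saddle_mat (0\<^sub>m m m) P) = 0"
      using det_0_iff_vec_prod_zero[OF S] y by (metis append_carrier_vec zero_carrier_vec)
    then show ?thesis using P 3 by (simp add: det_def)
  qed
qed

text \<open>
  The sum may range over all subsets \<open>Y\<close>, whatever their size: those for which the matrix is not
  square contribute \<open>0\<close>.  The list \<open>ws\<close> has to be arbitrary, because the induction step moves
  a vector to its end.  Adding the indices in descending order ensures that the vector
  moved there is the one that precedes all vectors of \<open>Y\<close>, so that the columns never need
  to be permuted.
\<close>

lemma det_saddle_mat_spectral_sum:
  fixes u :: "nat \<Rightarrow> 'a :: idom vec"
  assumes "finite I" and u: "\<And>i. u i \<in> carrier_vec m"
  shows "(-1) ^ length ws *
      det (saddle_mat (mat m m (\<lambda>(a, b). \<Sum>i\<in>I. lam i * (u i $ a * u i $ b))) (mat_of_cols m ws)) =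
    (\<Sum>Y\<in>Pow I. (det (mat_of_cols m (ws @ map u (sorted_list_of_set Y))))\<^sup>2 * (\<Prod>i\<in>Y. lam i))"
  using \<open>finite I\<close>
proof (induction I arbitrary: ws rule: finite_linorder_min_induct)
  case empty
  have M: "mat m m (\<lambda>(a, b). \<Sum>i\<in>{}. lam i * (u i $ a * u i $ b)) = 0\<^sub>m m m"
    by (auto intro!: eq_matI)
  show ?case
    unfolding M using det_saddle_mat_zero[of "mat_of_cols m ws" m "length ws"] by simp
next
  case (insert k I)
  let ?M = "\<lambda>I. mat m m (\<lambda>(a, b). \<Sum>i\<in>I. lam i * (u i $ a * u i $ b))"
  let ?g = "\<lambda>ws Y. (det (mat_of_cols m (ws @ map u (sorted_list_of_set Y))))\<^sup>2 * (\<Prod>i\<in>Y. lam i)"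
  have kI: "k \<notin> I" using insert.hyps by auto
  have M: "?M (insert k I) = ?M I + lam k \<cdot>\<^sub>m mat m m (\<lambda>(a, b). u k $ a * u k $ b)"
    using insert.hyps kI by (auto intro!: eq_matI simp: add.commute)
  have g: "?g ws (insert k Y) = lam k * ?g (ws @ [u k]) Y" if "Y \<in> Pow I" for Y
  proof -
    have fin: "finite Y" and kY: "k \<notin> Y" and less: "\<forall>a\<in>Y. k < a"
      using that insert.hyps kI by (auto dest: finite_subset)
    have "sorted_list_of_set (insert k Y) = k # sorted_list_of_set Y"
      using fin kY less by (simp add: insort_is_Cons less_imp_le)
    then show ?thesis using fin kY by simp
  qed
  have inj: "inj_on (insert k) (Pow I)"
    using kI by (auto simp: inj_on_def)
  have "(-1) ^ length ws * det (saddle_mat (?M (insert k I)) (mat_of_cols m ws))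
    = (-1) ^ length ws * det (saddle_mat (?M I) (mat_of_cols m ws))
      + lam k * ((-1) ^ length (ws @ [u k]) * det (saddle_mat (?M I) (mat_of_cols m (ws @ [u k]))))"
    unfolding M by (subst det_saddle_mat_add_rank_one) (auto simp: u algebra_simps)
  also have "\<dots> = sum (?g ws) (Pow I) + (\<Sum>Y\<in>Pow I. lam k * ?g (ws @ [u k]) Y)"
    unfolding insert.IH sum_distrib_left ..
  also have "(\<Sum>Y\<in>Pow I. lam k * ?g (ws @ [u k]) Y) = sum (?g ws) (insert k ` Pow I)"
    by (subst sum.reindex[OF inj]) (simp add: g del: map_append)
  also have "sum (?g ws) (Pow I) + sum (?g ws) (insert k ` Pow I) = sum (?g ws) (Pow (insert k I))"
    unfolding Pow_insert using insert.hyps kI by (subst sum.union_disjoint) auto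
  finally show ?case .
qed

section \<open>Invariance of saddle determinants\<close>

lemma det_saddle_mat_mult_right:
  fixes A :: "'a :: idom mat"
  assumes A: "A \<in> carrier_mat m m" and P: "P \<in> carrier_mat m p" and R: "R \<in> carrier_mat p p"
  shows "det (saddle_mat A (P * R)) = (det R)\<^sup>2 * det (saddle_mat A P)"
proof -
  define E where "E S = four_block_mat (1\<^sub>m m) (0\<^sub>m m p) (0\<^sub>m p m) S" for S :: "'a mat"
  have E: "E S \<in> carrier_mat (m + p) (m + p)" if "S \<in> carrier_mat p p" for S
    using that unfolding E_def by auto
  have detE: "det (E S) = det S" if "S \<in> carrier_mat p p" for S
    using that unfolding E_def
    by (subst det_four_block_mat_upper_right_zero[of _ m _ p]) auto
  have RT: "transpose_mat R \<in> carrier_mat p p" using R by simp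
  have S: "saddle_mat A P \<in> carrier_mat (m + p) (m + p)" using A P by (rule saddle_mat_carrier)
  have "saddle_mat A P * E R = four_block_mat A (P * R) (transpose_mat P) (0\<^sub>m p p)"
    using A P R unfolding saddle_mat_def E_def
    by (subst mult_four_block_mat[of _ m m _ p _ p _ _ m _ p]) auto
  then have "E (transpose_mat R) * (saddle_mat A P * E R) = saddle_mat A (P * R)"
    using A P R unfolding saddle_mat_def E_def
    by (simp, subst mult_four_block_mat[of _ m m _ p _ p _ _ m _ p]) (auto simp: transpose_mult)
  moreover have "det (E (transpose_mat R) * (saddle_mat A P * E R))
      = det (transpose_mat R) * (det (saddle_mat A P) * det R)"
    using det_mult[OF E[OF RT], of "saddle_mat A P * E R"] det_mult[OF S E[OF R]]
      detE[OF R] detE[OF RT] S E[OF R] by simp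
  ultimately show ?thesis using det_transpose[OF R] by (simp add: power2_eq_square)
qed

text \<open>
  Adding multiples of the border rows and columns to the first block row and column changes nothing
  else, because the border ends in a zero block.
\<close>

lemma det_saddle_mat_shift:
  fixes A :: "'a :: idom mat"
  assumes A: "A \<in> carrier_mat m m" and P: "P \<in> carrier_mat m p"
    and C: "C \<in> carrier_mat p m" and D: "D \<in> carrier_mat m p"
  shows "det (saddle_mat (A + P * C + D * transpose_mat P) P) = det (saddle_mat A P)"
proof -
  let ?G = "four_block_mat (1\<^sub>m m) (0\<^sub>m m p) C (1\<^sub>m p)"
  let ?H = "four_block_mat (1\<^sub>m m) D (0\<^sub>m p m) (1\<^sub>m p)"
  have G: "?G \<in> carrier_mat (m + p) (m + p)" and H: "?H \<in> carrier_mat (m + p) (m + p)" by auto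
  have S: "saddle_mat A P \<in> carrier_mat (m + p) (m + p)" using A P by (rule saddle_mat_carrier)
  have detG: "det ?G = 1" and detH: "det ?H = 1"
    using C D det_four_block_mat_upper_right_zero[of "1\<^sub>m m" m "0\<^sub>m m p" p C "1\<^sub>m p"]
      det_four_block_mat_lower_left_zero[of "1\<^sub>m m" m D p "0\<^sub>m p m" "1\<^sub>m p"] by auto
  have AC: "A + P * C \<in> carrier_mat m m" using A P C by auto
  have "saddle_mat A P * ?G = four_block_mat (A + P * C) P (transpose_mat P) (0\<^sub>m p p)"
    using A P C unfolding saddle_mat_def
    by (subst mult_four_block_mat[of _ m m _ p _ p _ _ m _ p]) auto
  then have "?H * (saddle_mat A P * ?G) = saddle_mat (A + P * C + D * transpose_mat P) P"
    using AC P C D unfolding saddle_mat_def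
    by (simp, subst mult_four_block_mat[of _ m m _ p _ p _ _ m _ p]) auto
  moreover have "det (?H * (saddle_mat A P * ?G)) = det (saddle_mat A P)"
    using det_mult[OF H, of "saddle_mat A P * ?G"] det_mult[OF S G] S G detG detH by simp
  ultimately show ?thesis by simp
qed

section \<open>Submatrices\<close>

text \<open>
  This relates the column order of \<open>submatrix\<close>, given by \<open>pick\<close>, to that of an explicit list of columns.
\<close>

lemma sorted_list_of_set_eq_map_pick:
  assumes "finite Y"
  shows "sorted_list_of_set Y = map (pick Y) [0..<card Y]"
proof -
  let ?xs = "map (pick Y) [0..<card Y]"
  have lt: "sorted_wrt (<) ?xs"
    by (auto simp: sorted_wrt_iff_nth_less intro!: pick_mono)
  moreover have "set ?xs = Y"
  proof -
    have "distinct ?xs" using lt by (simp add: strict_sorted_iff)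
    then have "card (set ?xs) = card Y" by (simp add: distinct_card del: set_map)
    moreover have "set ?xs \<subseteq> Y" by (auto intro!: pick_in_set)
    ultimately show ?thesis using assms card_subset_eq by blast
  qed
  ultimately show ?thesis
    using assms sorted_list_of_set_unique by (metis length_map length_upt minus_nat.diff_0)
qed


lemma submatrix_carrier:
  assumes "A \<in> carrier_mat n k"
  shows "submatrix A X Y \<in> carrier_mat (card {i. i < n \<and> i \<in> X}) (card {j. j < k \<and> j \<in> Y})"
  using assms by (auto simp: submatrix_def)

lemma submatrix_add:
  assumes "A \<in> carrier_mat n k" "B \<in> carrier_mat n k"
  shows "submatrix (A + B) X Y = submatrix A X Y + submatrix B X Y"
  using assms by (auto intro!: eq_matI simp: submatrix_def pick_le)

lemma transpose_submatrix:
  "transpose_mat (submatrix A X Y) = submatrix (transpose_mat A) Y X"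
  by (auto intro!: eq_matI simp: submatrix_def pick_le)

lemma submatrix_mult:
  assumes "A \<in> carrier_mat n k" "B \<in> carrier_mat k l"
  shows "submatrix (A * B) X Y = submatrix A X UNIV * submatrix B UNIV Y"
  using assms by (auto intro!: eq_matI simp: submatrix_def pick_le pick_UNIV scalar_prod_def)

section \<open>Factoring out an orthonormal basis\<close>

lemma col_space_subset_imp_factor:
  fixes V :: "'a :: field mat"
  assumes V: "V \<in> carrier_mat n k" and Q: "Q \<in> carrier_mat n p"
    and sub: "vec_space.col_space n V \<subseteq> vec_space.col_space n Q"
  shows "\<exists>R \<in> carrier_mat p k. V = Q * R"
proof -
  have "\<exists>x \<in> carrier_vec p. Q *\<^sub>v x = col V j" if "j < k" for j
  proof -
    have "V *\<^sub>v unit_vec k j = col V j"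
      using V that by (auto intro!: eq_vecI)
    then have "col V j \<in> vec_space.col_space n V"
      unfolding vec_space.col_space_eq[OF V] using V by (auto intro!: bexI[of _ "unit_vec k j"])
    then show ?thesis using sub vec_space.col_space_eq[OF Q] Q by auto
  qed
  then obtain x where x: "\<And>j. j < k \<Longrightarrow> x j \<in> carrier_vec p"
    and Qx: "\<And>j. j < k \<Longrightarrow> Q *\<^sub>v x j = col V j" by metis
  define R where "R = mat p k (\<lambda>(i, j). x j $ i)"
  have colR: "col R j = x j" if "j < k" for j
    using x[OF that] that unfolding R_def by (auto intro!: eq_vecI)
  have "V = Q * R"
  proof (rule eq_matI)
    fix i j assume "i < dim_row (Q * R)" "j < dim_col (Q * R)"
    then have i: "i < n" and j: "j < k" using Q unfolding R_def by auto
    have "V $$ (i, j) = (Q *\<^sub>v x j) $ i" unfolding Qx[OF j] using V i j by simp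
    then show "V $$ (i, j) = (Q * R) $$ (i, j)" using Q V i j colR[OF j] by (simp add: R_def)
  qed (use V Q in \<open>auto simp: R_def\<close>)
  moreover have "R \<in> carrier_mat p k" unfolding R_def by simp
  ultimately show ?thesis by blast
qed

lemma orthonormal_cols_gram:
  assumes "orthonormal_cols Q"
  shows "transpose_mat Q * Q = 1\<^sub>m (dim_col Q)"
  using assms unfolding orthonormal_cols_def by (auto intro!: eq_matI)

text \<open>
  With the complementary matrices \<open>E = Q Q\<^sup>T\<close> and \<open>F = 1 - E\<close>, expanding \<open>L = (F + E) L\<close> and then
  \<open>F L = F L (F + E)\<close> leaves two correction terms, one with the left factor \<open>Q\<close> and one with the
  right factor \<open>Q\<^sup>T\<close>: exactly the shape that does not change the determinant of a saddle matrix.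
\<close>

lemma split_off_projection:
  fixes L :: "'a :: comm_ring_1 mat"
  assumes L: "L \<in> carrier_mat n n" and Q: "Q \<in> carrier_mat n p"
  shows "L = (1\<^sub>m n - Q * transpose_mat Q) * L * (1\<^sub>m n - Q * transpose_mat Q)
    + Q * (transpose_mat Q * L) + (1\<^sub>m n - Q * transpose_mat Q) * L * Q * transpose_mat Q"
proof -
  have QT: "transpose_mat Q \<in> carrier_mat p n" using Q by simp
  define E where "E = Q * transpose_mat Q"
  define F where "F = 1\<^sub>m n - E"
  have E: "E \<in> carrier_mat n n" unfolding E_def using Q by auto
  have F: "F \<in> carrier_mat n n" unfolding F_def using E by auto
  have FL: "F * L \<in> carrier_mat n n" using F L by auto
  have FE: "F + E = 1\<^sub>m n" unfolding F_def using E by (auto intro!: eq_matI)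
  have "L = F * L + E * L"
    using add_mult_distrib_mat[OF F E L] FE L by simp
  moreover have "F * L = F * L * F + F * L * E"
    using mult_add_distrib_mat[OF FL F E] right_mult_one_mat[OF FL] unfolding FE by argo
  ultimately have "L = F * L * F + F * L * E + E * L" by argo
  also have "\<dots> = F * L * F + E * L + F * L * E"
    using F E L by (auto intro!: eq_matI)
  also have "E * L = Q * (transpose_mat Q * L)"
    unfolding E_def by (rule assoc_mult_mat[OF Q QT L])
  also have "F * L * E = F * L * Q * transpose_mat Q"
    unfolding E_def by (rule assoc_mult_mat[OF FL Q QT, symmetric])
  finally show ?thesis unfolding F_def E_def .
qed

section \<open>The determinant expansion\<close>

theorem theorem3p1:
  fixes L V Q Lt U :: "real mat" and lam :: "nat \<Rightarrow> real"
    and n p q m :: nat and X :: "nat set"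
  assumes "nonnegative_pair n p L V"
    and "orthonormal_basis_of_col_space n p Q V"
    and "Lt = (1\<^sub>m n - Q * transpose_mat Q) * L * (1\<^sub>m n - Q * transpose_mat Q)"
    and "q = vec_space.rank n Lt"
    and "truncated_spectral_decomposition n q Lt U lam"
    and "X \<subseteq> {..<n}" and "card X = m" and "p \<le> m" and "m \<le> p + q"
  shows "(-1) ^ p *
      det (four_block_mat (submatrix L X X) (submatrix V X UNIV)
             (transpose_mat (submatrix V X UNIV)) (0\<^sub>m p p)) =
    det (transpose_mat V * V) *
      (\<Sum>Y \<in> {Y. Y \<subseteq> {..<q} \<and> card Y = m - p}.
         (det (append_cols (submatrix Q X UNIV) (submatrix U X Y)))\<^sup>2 * (\<Prod>i\<in>Y. lam i))"
proof -
  let ?QX = "submatrix Q X UNIV"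
  let ?P = "1\<^sub>m n - Q * transpose_mat Q"
  \<comment> \<open>column \<open>i\<close> of \<open>U\<close>, restricted to the rows in \<open>X\<close>\<close>
  define u where "u i = vec m (\<lambda>a. U $$ (pick X a, i))" for i
  have L: "L \<in> carrier_mat n n" and V: "V \<in> carrier_mat n p"
    using assms(1) by (auto simp: nonnegative_pair_def)
  have Q: "Q \<in> carrier_mat n p" and orthonormal: "orthonormal_cols Q"
    and col: "vec_space.col_space n Q = vec_space.col_space n V"
    using assms(2) by (simp_all add: orthonormal_basis_of_col_space_def)
  have orth: "transpose_mat Q * Q = 1\<^sub>m p"
    using orthonormal_cols_gram[OF orthonormal] Q by simp
  have U: "U \<in> carrier_mat n q" and Lt: "Lt = U * mat_diag q lam * transpose_mat U"
    using assms(5) unfolding truncated_spectral_decomposition_def by blast+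
  have card_X: "card {i. i < n \<and> i \<in> X} = m"
  proof -
    have "{i. i < n \<and> i \<in> X} = X" using assms(6) by auto
    then show ?thesis using assms(7) by simp
  qed
  have pick_X: "pick X i < n" if "i < m" for i using pick_le that card_X by metis
  have sub_cols: "submatrix A X UNIV \<in> carrier_mat m k" if "A \<in> carrier_mat n k" for A :: "real mat" and k
    using submatrix_carrier[OF that, of X UNIV] card_X by simp
  have sub_rows: "submatrix A UNIV X \<in> carrier_mat k m" if "A \<in> carrier_mat k n" for A :: "real mat" and k
    using submatrix_carrier[OF that, of UNIV X] card_X by simp
  have sub_sq: "submatrix A X X \<in> carrier_mat m m" if "A \<in> carrier_mat n n" for A :: "real mat"
    using submatrix_carrier[OF that, of X X] card_X by simp
  have QX: "?QX \<in> carrier_mat m p" using Q by (rule sub_cols)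
  have Ltc: "Lt \<in> carrier_mat n n" unfolding Lt using U by auto

  obtain R where R: "R \<in> carrier_mat p p" and VQR: "V = Q * R"
    using col_space_subset_imp_factor[OF V Q] col by auto
  have VX: "submatrix V X UNIV = ?QX * R"
  proof -
    have "submatrix R UNIV UNIV = R"
      using R by (auto intro!: eq_matI simp: submatrix_def pick_UNIV)
    then show ?thesis unfolding VQR using submatrix_mult[OF Q R, of X UNIV] by simp
  qed
  have gram: "det (transpose_mat V * V) = (det R)\<^sup>2"
  proof -
    have QT: "transpose_mat Q \<in> carrier_mat p n" and RT: "transpose_mat R \<in> carrier_mat p p"
      and QR: "Q * R \<in> carrier_mat n p" using Q R by auto
    have "transpose_mat V * V = transpose_mat R * transpose_mat Q * (Q * R)"
      unfolding VQR using transpose_mult[OF Q R] by simp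
    also have "\<dots> = transpose_mat R * (transpose_mat Q * (Q * R))"
      by (rule assoc_mult_mat[OF RT QT QR])
    also have "transpose_mat Q * (Q * R) = transpose_mat Q * Q * R"
      by (rule assoc_mult_mat[OF QT Q R, symmetric])
    also have "\<dots> = R" using R orth by simp
    finally show ?thesis
      using det_mult[OF RT R] det_transpose[OF R] by (simp add: power2_eq_square)
  qed

  have L_split: "L = Lt + Q * (transpose_mat Q * L) + ?P * L * Q * transpose_mat Q"
    unfolding assms(3) by (rule split_off_projection[OF L Q])
  have LX: "submatrix L X X = submatrix Lt X X + ?QX * submatrix (transpose_mat Q * L) UNIV X
      + submatrix (?P * L * Q) X UNIV * transpose_mat ?QX"
  proof -
    have C: "transpose_mat Q * L \<in> carrier_mat p n" and D: "?P * L * Q \<in> carrier_mat n p"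
      and QT: "transpose_mat Q \<in> carrier_mat p n"
      using Q L by auto
    have "submatrix L X X = submatrix (Lt + Q * (transpose_mat Q * L) + ?P * L * Q * transpose_mat Q) X X"
      using L_split by (rule arg_cong)
    also have "\<dots> = submatrix Lt X X + submatrix (Q * (transpose_mat Q * L)) X X
        + submatrix (?P * L * Q * transpose_mat Q) X X"
    proof -
      have 1: "Q * (transpose_mat Q * L) \<in> carrier_mat n n" using Q C by (rule mult_carrier_mat)
      have 2: "?P * L * Q * transpose_mat Q \<in> carrier_mat n n" using D QT by (rule mult_carrier_mat)
      show ?thesis
        using submatrix_add[OF add_carrier_mat[OF 1] 2] submatrix_add[OF Ltc 1] by metis
    qed
    finally show ?thesis
      using submatrix_mult[OF Q C] submatrix_mult[OF D QT] by (simp add: transpose_submatrix)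
  qed

  have LtX: "submatrix Lt X X = mat m m (\<lambda>(a, b). \<Sum>i\<in>{..<q}. lam i * (u i $ a * u i $ b))"
  proof (rule eq_matI)
    fix a b
    assume "a < dim_row (mat m m (\<lambda>(a, b). \<Sum>i\<in>{..<q}. lam i * (u i $ a * u i $ b)))"
      and "b < dim_col (mat m m (\<lambda>(a, b). \<Sum>i\<in>{..<q}. lam i * (u i $ a * u i $ b)))"
    then have a: "a < m" and b: "b < m" by auto
    have "submatrix Lt X X $$ (a, b) = Lt $$ (pick X a, pick X b)"
      using Ltc a b card_X by (intro submatrix_index) auto
    also have "\<dots> = (\<Sum>i\<in>{..<q}. U $$ (pick X a, i) * lam i * U $$ (pick X b, i))"
      unfolding Lt mat_diag_mult_right[OF U] using U pick_X[OF a] pick_X[OF b]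
      by (simp add: scalar_prod_def atLeast0LessThan)
    also have "\<dots> = (\<Sum>i\<in>{..<q}. lam i * (u i $ a * u i $ b))"
      using a b by (intro sum.cong) (auto simp: u_def)
    finally show "submatrix Lt X X $$ (a, b)
        = mat m m (\<lambda>(a, b). \<Sum>i\<in>{..<q}. lam i * (u i $ a * u i $ b)) $$ (a, b)"
      using a b by simp
  qed (use sub_sq[OF Ltc] in auto)

  have UXY: "submatrix U X Y \<in> carrier_mat m (card Y)" if "Y \<subseteq> {..<q}" for Y
  proof -
    have "{j. j < q \<and> j \<in> Y} = Y" using that by auto
    then show ?thesis using submatrix_carrier[OF U, of X Y] card_X by simp
  qed
  have append: "mat_of_cols m (cols ?QX @ map u (sorted_list_of_set Y))
      = append_cols ?QX (submatrix U X Y)" if Y: "Y \<subseteq> {..<q}" for Y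
  proof -
    have fin: "finite Y" using Y finite_subset by blast
    have UY: "{j. j < q \<and> j \<in> Y} = Y" using Y by auto
    have "submatrix U X Y $$ (a, j) = u (pick Y j) $ a" if "a < m" "j < card Y" for a j
      using that U card_X UY by (subst submatrix_index) (auto simp: u_def)
    then show ?thesis
      using QX UXY[OF Y] unfolding append_cols_def sorted_list_of_set_eq_map_pick[OF fin]
      by (auto intro!: eq_matI simp: mat_of_cols_index nth_append)
  qed
  \<comment> \<open>A set \<open>Y\<close> of the wrong size makes the matrix non-square.\<close>
  have zero: "det (append_cols ?QX (submatrix U X Y)) = 0" if "Y \<subseteq> {..<q}" "card Y \<noteq> m - p" for Y
    using QX UXY[OF that(1)] that(2) assms(8) by (simp add: append_cols_def det_def)

  have cols_QX: "mat_of_cols m (cols ?QX) = ?QX"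
    using mat_of_cols_cols[of ?QX] QX by simp
  have u_dim: "u i \<in> carrier_vec m" for i unfolding u_def by simp
  have "(-1) ^ p * det (saddle_mat (submatrix Lt X X) ?QX)
    = (\<Sum>Y\<in>Pow {..<q}. (det (append_cols ?QX (submatrix U X Y)))\<^sup>2 * (\<Prod>i\<in>Y. lam i))"
    using det_saddle_mat_spectral_sum[of "{..<q}" u m "cols ?QX" lam] QX LtX append cols_QX u_dim
    by simp
  also have "\<dots> = (\<Sum>Y\<in>{Y. Y \<subseteq> {..<q} \<and> card Y = m - p}.
      (det (append_cols ?QX (submatrix U X Y)))\<^sup>2 * (\<Prod>i\<in>Y. lam i))"
    using zero by (intro sum.mono_neutral_right) auto
  finally have main: "(-1) ^ p * det (saddle_mat (submatrix Lt X X) ?QX) = \<dots>" .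

  have "four_block_mat (submatrix L X X) (submatrix V X UNIV)
      (transpose_mat (submatrix V X UNIV)) (0\<^sub>m p p) = saddle_mat (submatrix L X X) (?QX * R)"
    unfolding saddle_mat_def VX using R by simp
  also have "det \<dots> = (det R)\<^sup>2 * det (saddle_mat (submatrix L X X) ?QX)"
    by (rule det_saddle_mat_mult_right[OF sub_sq[OF L] QX R])
  also have "det (saddle_mat (submatrix L X X) ?QX) = det (saddle_mat (submatrix Lt X X) ?QX)"
    unfolding LX using Q L
    by (intro det_saddle_mat_shift[OF sub_sq[OF Ltc] QX] sub_rows sub_cols) auto
  finally show ?thesis
    unfolding gram main[symmetric] by simp
qed

end
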